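(* Let $\alpha=(\alpha_\xi(t))_{\xi\in X}$ be a solution of the semi-discrete system $$\dot\alpha = A^{-1}DA^{-1}\,\nabla_\alpha E[u_h],\qquad u_h(t,\cdot)=\sum_{\xi\in X}\alpha_\xi(t)\chi_\xi(\cdot).$$ Then the energy is dissipated along the solution: $$\frac{d}{dt}E[u_h]\le 0 .$$
   Context: $\mathcal S\subset\mathbb R^d$ is a closed, compact, connected, $C^\infty$ surface of intrinsic dimension $d_{\mathcal S}=d-1$, and $\langle\cdot,\cdot\rangle_{L^2(\mathcal S)}$ is the $L^2$ inner product of real functions on $\mathcal S$. $\mathcal U$ is a space of differentiable functions $u$ on $\mathcal S\times(0,T]$. The PDE considered is $\dot u=\mathcal N\frac{\delta E}{\delta u}[u]$, where $E:\mathcal U\to\mathbb R$ is a functional with functional derivative $\frac{\delta E}{\delta u}$, and $\mathcal N$ is a linear self-adjoint negative (semi-)definite operator, i.e. $\langle u,\mathcal N u\rangle_{L^2(\mathcal S)}\le 0$ for all $u\in\mathcal U$. $X\subset\mathcal S$ is a finite set of $N_X$ distinct points. $\phi_m$ is the positive definite Matérn kernel on $\mathcal S$, the reproducing kernel of the Sobolev space $W_2^m(\mathcal S)$ (it is the fundamental solution of $\sum_{j=0}^m(\nabla_S^j)^*\nabla_S^j$, with $\nabla_S$ the covariant derivative and $^*$ the $L_2(\mathcal S)$-adjoint). $V_{X,\phi_m}=\mathrm{span}\{\phi_m(\cdot,x):x\in X\}\subset\mathcal U$. For $\xi\in X$, $\chi_\xi\in V_{X,\phi_m}$ is the Lagrange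 function: the unique element with $\chi_\xi(\xi)=1$ and $\chi_\xi(\eta)=0$ for $\eta\in X\setminus\{\xi\}$; these form a basis of $V_{X,\phi_m}$. $A=\big[\langle\chi_\xi,\chi_\eta\rangle_{L^2(\mathcal S)}\big]_{\xi,\eta\in X}$ and $D=\big[\langle\chi_\xi,\mathcal N\chi_\eta\rangle_{L^2(\mathcal S)}\big]_{\xi,\eta\in X}$ are real $N_X\times N_X$ matrices. $\nabla_\alpha E[u_h]$ is the gradient of $\alpha\mapsto E\big[\sum_{\xi}\alpha_\xi\chi_\xi\big]$ with respect to the coefficient vector $\alpha\in\mathbb R^{N_X}$. *)

theory Defs
  imports "HOL-Analysis.Analysis"
begin

subsection \<open>Smooth maps and smooth hypersurfaces\<close>

primrec Ck_on :: "nat \<Rightarrow> 'a::euclidean_space set \<Rightarrow> ('a \<Rightarrow> 'b::euclidean_space) \<Rightarrow> bool" where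
  "Ck_on 0 W f \<longleftrightarrow> continuous_on W f"
| "Ck_on (Suc k) W f \<longleftrightarrow>
     (\<forall>x\<in>W. f differentiable (at x)) \<and>
     (\<forall>v. Ck_on k W (\<lambda>x. frechet_derivative f (at x) v))"

text \<open>
  Smoothness on an arbitrary subset of Euclidean space: \<open>f\<close> locally agrees with a \<open>C\<^sup>\<infinity>\<close>
  map on an open subset of the ambient space. For open \<open>S\<close> this is ordinary smoothness; for an
  embedded submanifold it is smoothness in charts.
\<close>

definition smooth_on :: "'a::euclidean_space set \<Rightarrow> ('a \<Rightarrow> 'b::euclidean_space) \<Rightarrow> bool" where
  "smooth_on S f \<longleftrightarrow>
     (\<forall>p\<in>S. \<exists>W F. open W \<and> p \<in> W \<and> (\<forall>k. Ck_on k W F) \<and> (\<forall>x\<in>S \<inter> W. F x = f x))"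

definition local_parametrization ::
    "(real^'n) set \<Rightarrow> (real^'m) set \<Rightarrow> (real^'m \<Rightarrow> real^'n) \<Rightarrow> bool" where
  "local_parametrization S U \<psi> \<longleftrightarrow>
     open U \<and> smooth_on U \<psi> \<and>
     (\<forall>u\<in>U. inj (frechet_derivative \<psi> (at u))) \<and>
     openin (top_of_set S) (\<psi> ` U) \<and>
     (\<exists>\<theta>. homeomorphism U (\<psi> ` U) \<psi> \<theta>)"

text \<open>
  Compact connected embedded \<open>C\<^sup>\<infinity>\<close> submanifold without boundary of intrinsic dimension
  \<open>CARD('m)\<close>; the type argument carries the intrinsic dimension.
\<close>

definition closed_smooth_surface :: "'m::finite itself \<Rightarrow> (real^'n) set \<Rightarrow> bool" where
  "closed_smooth_surface _ S \<longleftrightarrow>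
     compact S \<and> connected S \<and> S \<noteq> {} \<and>
     (\<forall>p\<in>S. \<exists>U (\<psi> :: real^'m \<Rightarrow> real^'n). local_parametrization S U \<psi> \<and> p \<in> \<psi> ` U)"

text \<open>
  The Riemannian surface measure is the unique Borel measure on \<open>S\<close> which in every local
  parametrization has density \<open>\<surd>det (D\<psi>\<^sup>T D\<psi>)\<close> with respect to Lebesgue measure.
\<close>

definition gram_density :: "(real^'m \<Rightarrow> real^'n) \<Rightarrow> real^'m \<Rightarrow> real" where
  "gram_density \<psi> u =
     (let J = matrix (frechet_derivative \<psi> (at u)) in sqrt (det (transpose J ** J)))"

definition surface_measure ::
    "'m::finite itself \<Rightarrow> (real^'n) set \<Rightarrow> (real^'n) measure \<Rightarrow> bool" where
  "surface_measure _ S \<sigma> \<longleftrightarrow>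
     sets \<sigma> = sets (restrict_space borel S) \<and>
     (\<forall>U (\<psi> :: real^'m \<Rightarrow> real^'n) B.
        local_parametrization S U \<psi> \<longrightarrow> B \<in> sets borel \<longrightarrow> B \<subseteq> U \<longrightarrow>
        emeasure \<sigma> (\<psi> ` B) = (\<integral>\<^sup>+ u. ennreal (gram_density \<psi> u) * indicator B u \<partial>lborel))"

subsection \<open>The space \<open>L\<^sup>2(S)\<close>\<close>

text \<open>
  Functions on \<open>S\<close> are total functions on the ambient space of which only the values on \<open>S\<close>
  matter, since \<open>\<sigma>\<close> is a measure with underlying space \<open>S\<close>.
\<close>

definition l2_space :: "'a measure \<Rightarrow> ('a \<Rightarrow> real) set" where
  "l2_space \<sigma> = {f. f \<in> borel_measurable \<sigma> \<and> integrable \<sigma> (\<lambda>x. (f x)\<^sup>2)}"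

definition l2_inner :: "'a measure \<Rightarrow> ('a \<Rightarrow> real) \<Rightarrow> ('a \<Rightarrow> real) \<Rightarrow> real" where
  "l2_inner \<sigma> f g = (\<integral>x. f x * g x \<partial>\<sigma>)"

subsection \<open>Covariant derivatives, Sobolev spaces and the Matern kernel\<close>

definition tangent_space :: "(real^'n) set \<Rightarrow> real^'n \<Rightarrow> (real^'n) set" where
  "tangent_space S x =
     {v. \<exists>\<gamma> :: real \<Rightarrow> real^'n. (\<forall>t. \<gamma> t \<in> S) \<and> \<gamma> 0 = x \<and> (\<gamma> has_vector_derivative v) (at 0)}"

definition tangent_proj :: "(real^'n) set \<Rightarrow> real^'n \<Rightarrow> real^'n \<Rightarrow> real^'n" where
  "tangent_proj S x v = closest_point (tangent_space S x) v"

text \<open>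
  \<open>cov_deriv S f [v\<^sub>1, \<dots>, v\<^sub>j] x\<close> is the \<open>j\<close>-th covariant derivative \<open>\<nabla>\<^sub>S\<^sup>jf\<close> at \<open>x\<close>,
  evaluated at the tangential parts of \<open>v\<^sub>1, \<dots>, v\<^sub>j\<close>. As the Levi-Civita connection of an
  embedded surface is the tangential part of the ambient derivative, \<open>\<nabla>\<^sub>S T\<close> arises by
  differentiating \<open>T\<close> along \<open>S\<close> and projecting all arguments to the tangent space.
  The Frechet derivative within \<open>S\<close> is unique only on tangent vectors, and is only applied to
  those.
\<close>

fun cov_deriv :: "(real^'n) set \<Rightarrow> (real^'n \<Rightarrow> real) \<Rightarrow> (real^'n) list \<Rightarrow> real^'n \<Rightarrow> real" where
  "cov_deriv S f [] x = f x"
| "cov_deriv S f (v # vs) x =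
     frechet_derivative (\<lambda>y. cov_deriv S f (map (tangent_proj S x) vs) y) (at x within S)
       (tangent_proj S x v)"

text \<open>
  The pointwise inner product of \<open>\<nabla>\<^sub>S\<^sup>jf\<close> and \<open>\<nabla>\<^sub>S\<^sup>jg\<close>. Both tensors vanish on normal
  vectors, so the sum over an ambient orthonormal basis equals the one over an orthonormal basis
  of the tangent space.
\<close>

definition cov_inner ::
    "(real^'n) set \<Rightarrow> nat \<Rightarrow> (real^'n \<Rightarrow> real) \<Rightarrow> (real^'n \<Rightarrow> real) \<Rightarrow> real^'n \<Rightarrow> real" where
  "cov_inner S j f g x =
     (\<Sum>vs\<in>{vs. set vs \<subseteq> Basis \<and> length vs = j}. cov_deriv S f vs x * cov_deriv S g vs x)"

definition smooth_sobolev_inner ::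
    "(real^'n) set \<Rightarrow> (real^'n) measure \<Rightarrow> nat \<Rightarrow> (real^'n \<Rightarrow> real) \<Rightarrow> (real^'n \<Rightarrow> real) \<Rightarrow> real" where
  "smooth_sobolev_inner S \<sigma> m f g = (\<Sum>j\<le>m. \<integral>x. cov_inner S j f g x \<partial>\<sigma>)"

text \<open>
  \<open>W\<^sub>2\<^sup>m(S)\<close> is the completion of \<open>C\<^sup>\<infinity>(S)\<close> in the norm induced by
  \<open>smooth_sobolev_inner\<close>, realised inside \<open>L\<^sup>2(S)\<close>.
  Its elements are represented by continuous functions: in the only range where it has a
  reproducing kernel, \<open>2 m > dim S\<close>, every class has a unique continuous representative.
\<close>

definition sobolev_approx ::
    "(real^'n) set \<Rightarrow> (real^'n) measure \<Rightarrow> nat \<Rightarrow> (real^'n \<Rightarrow> real) \<Rightarrow>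
     (nat \<Rightarrow> real^'n \<Rightarrow> real) \<Rightarrow> bool" where
  "sobolev_approx S \<sigma> m f F \<longleftrightarrow>
     (\<forall>n. smooth_on S (F n)) \<and>
     (\<forall>e>0. \<exists>M. \<forall>i\<ge>M. \<forall>j\<ge>M.
        smooth_sobolev_inner S \<sigma> m (\<lambda>x. F i x - F j x) (\<lambda>x. F i x - F j x) < e) \<and>
     (\<lambda>n. \<integral>x. (F n x - f x)\<^sup>2 \<partial>\<sigma>) \<longlonglongrightarrow> 0"

definition sobolev_space ::
    "(real^'n) set \<Rightarrow> (real^'n) measure \<Rightarrow> nat \<Rightarrow> (real^'n \<Rightarrow> real) set" where
  "sobolev_space S \<sigma> m = {f. continuous_on S f \<and> (\<exists>F. sobolev_approx S \<sigma> m f F)}"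

definition sobolev_inner ::
    "(real^'n) set \<Rightarrow> (real^'n) measure \<Rightarrow> nat \<Rightarrow> (real^'n \<Rightarrow> real) \<Rightarrow> (real^'n \<Rightarrow> real) \<Rightarrow> real" where
  "sobolev_inner S \<sigma> m f g =
     (THE c. \<forall>F G. sobolev_approx S \<sigma> m f F \<longrightarrow> sobolev_approx S \<sigma> m g G \<longrightarrow>
        (\<lambda>n. smooth_sobolev_inner S \<sigma> m (F n) (G n)) \<longlonglongrightarrow> c)"

text \<open>
  The reproducing kernel of \<open>W\<^sub>2\<^sup>m(S)\<close>. Since the inner product is
  \<open>\<Sum>j\<le>m. \<langle>\<nabla>\<^sub>S\<^sup>jf, \<nabla>\<^sub>S\<^sup>jg\<rangle>\<close>, the reproducing identity is the weak form of
  \<open>\<phi>\<close> being the fundamental solution of \<open>\<Sum>j\<le>m. (\<nabla>\<^sub>S\<^sup>j)\<^sup>*\<nabla>\<^sub>S\<^sup>j\<close>.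
  Symmetry and positive definiteness are consequences.
\<close>

definition matern_kernel ::
    "(real^'n) set \<Rightarrow> (real^'n) measure \<Rightarrow> nat \<Rightarrow> (real^'n \<Rightarrow> real^'n \<Rightarrow> real) \<Rightarrow> bool" where
  "matern_kernel S \<sigma> m \<phi> \<longleftrightarrow>
     (\<forall>x\<in>S. (\<lambda>y. \<phi> y x) \<in> sobolev_space S \<sigma> m) \<and>
     (\<forall>f\<in>sobolev_space S \<sigma> m. \<forall>x\<in>S. sobolev_inner S \<sigma> m f (\<lambda>y. \<phi> y x) = f x)"

subsection \<open>Trial space, Lagrange functions and Galerkin matrices\<close>

definition kernel_span :: "'a set \<Rightarrow> ('a \<Rightarrow> 'a \<Rightarrow> real) \<Rightarrow> ('a \<Rightarrow> real) set" where
  "kernel_span X \<phi> = {v. \<exists>c. v = (\<lambda>y. \<Sum>x\<in>X. c x * \<phi> y x)}"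

definition lagrange_functions ::
    "('a \<Rightarrow> 'a \<Rightarrow> real) \<Rightarrow> ('k \<Rightarrow> 'a) \<Rightarrow> ('k \<Rightarrow> 'a \<Rightarrow> real) \<Rightarrow> bool" where
  "lagrange_functions \<phi> x L \<longleftrightarrow>
     (\<forall>i. L i \<in> kernel_span (range x) \<phi>) \<and>
     (\<forall>i j. L i (x j) = (if i = j then 1 else 0))"

definition lin_comb :: "('k::finite \<Rightarrow> 'a \<Rightarrow> real) \<Rightarrow> real^'k \<Rightarrow> 'a \<Rightarrow> real" where
  "lin_comb L a = (\<lambda>y. \<Sum>i\<in>UNIV. a $ i * L i y)"

definition mass_matrix :: "'a measure \<Rightarrow> ('k::finite \<Rightarrow> 'a \<Rightarrow> real) \<Rightarrow> real^'k^'k" where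
  "mass_matrix \<sigma> L = (\<chi> i j. l2_inner \<sigma> (L i) (L j))"

definition operator_matrix ::
    "'a measure \<Rightarrow> (('a \<Rightarrow> real) \<Rightarrow> 'a \<Rightarrow> real) \<Rightarrow> ('k::finite \<Rightarrow> 'a \<Rightarrow> real) \<Rightarrow> real^'k^'k" where
  "operator_matrix \<sigma> N L = (\<chi> i j. l2_inner \<sigma> (L i) (N (L j)))"

subsection \<open>Function space, operator and energy\<close>

definition function_space :: "(real^'n) set \<Rightarrow> (real^'n \<Rightarrow> real) set \<Rightarrow> bool" where
  "function_space S \<U> \<longleftrightarrow>
     (\<lambda>x. 0) \<in> \<U> \<and>
     (\<forall>u\<in>\<U>. \<forall>v\<in>\<U>. \<forall>a b. (\<lambda>x. a * u x + b * v x) \<in> \<U>) \<and>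
     (\<forall>u\<in>\<U>. u differentiable_on S)"

definition linear_l2_operator ::
    "'a measure \<Rightarrow> ('a \<Rightarrow> real) set \<Rightarrow> (('a \<Rightarrow> real) \<Rightarrow> 'a \<Rightarrow> real) \<Rightarrow> bool" where
  "linear_l2_operator \<sigma> \<U> N \<longleftrightarrow>
     (\<forall>u\<in>\<U>. N u \<in> l2_space \<sigma>) \<and>
     (\<forall>u\<in>\<U>. \<forall>v\<in>\<U>. \<forall>a b. AE x in \<sigma>. N (\<lambda>y. a * u y + b * v y) x = a * N u x + b * N v x)"

text \<open>Formal self-adjointness on \<open>\<U>\<close>; no assertion about the domain of the adjoint is made.\<close>

definition self_adjoint_on ::
    "'a measure \<Rightarrow> ('a \<Rightarrow> real) set \<Rightarrow> (('a \<Rightarrow> real) \<Rightarrow> 'a \<Rightarrow> real) \<Rightarrow> bool" where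
  "self_adjoint_on \<sigma> \<U> N \<longleftrightarrow> (\<forall>u\<in>\<U>. \<forall>v\<in>\<U>. l2_inner \<sigma> u (N v) = l2_inner \<sigma> (N u) v)"

definition negative_semidefinite_on ::
    "'a measure \<Rightarrow> ('a \<Rightarrow> real) set \<Rightarrow> (('a \<Rightarrow> real) \<Rightarrow> 'a \<Rightarrow> real) \<Rightarrow> bool" where
  "negative_semidefinite_on \<sigma> \<U> N \<longleftrightarrow> (\<forall>u\<in>\<U>. l2_inner \<sigma> u (N u) \<le> 0)"

definition has_functional_derivative ::
    "'a measure \<Rightarrow> ('a \<Rightarrow> real) set \<Rightarrow> (('a \<Rightarrow> real) \<Rightarrow> real) \<Rightarrow>
     (('a \<Rightarrow> real) \<Rightarrow> 'a \<Rightarrow> real) \<Rightarrow> bool" where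
  "has_functional_derivative \<sigma> \<U> E \<delta>E \<longleftrightarrow>
     (\<forall>u\<in>\<U>. \<delta>E u \<in> l2_space \<sigma> \<and>
        (\<forall>v\<in>\<U>. ((\<lambda>\<epsilon>. E (\<lambda>x. u x + \<epsilon> * v x)) has_real_derivative l2_inner \<sigma> (\<delta>E u) v) (at 0)))"

subsection \<open>The semi-discrete system\<close>

text \<open>
  \<open>g\<close> is the gradient of \<open>a \<mapsto> E (\<Sum>i. a\<^sub>i L\<^sub>i)\<close> at \<open>\<alpha> t\<close>, in the sense of the total
  derivative; its existence is part of what it means to be a solution.
  At \<open>t = T\<close> the time derivative is one-sided.
\<close>

definition semidiscrete_solution ::
    "'a measure \<Rightarrow> (('a \<Rightarrow> real) \<Rightarrow> 'a \<Rightarrow> real) \<Rightarrow> (('a \<Rightarrow> real) \<Rightarrow> real) \<Rightarrow>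
     ('k::finite \<Rightarrow> 'a \<Rightarrow> real) \<Rightarrow> real \<Rightarrow> (real \<Rightarrow> real^'k) \<Rightarrow> bool" where
  "semidiscrete_solution \<sigma> N E L T \<alpha> \<longleftrightarrow>
     (\<forall>t\<in>{0<..T}. \<exists>g.
        (GDERIV (\<lambda>a. E (lin_comb L a)) (\<alpha> t) :> g) \<and>
        (\<alpha> has_vector_derivative
           (matrix_inv (mass_matrix \<sigma> L) ** operator_matrix \<sigma> N L ** matrix_inv (mass_matrix \<sigma> L)) *v g)
          (at t within {0<..T}))"

end

theory Submission
  imports Defs
begin

text \<open>
  By the chain rule, \<open>d/dt E[u\<^sub>h]\<close> is the inner product of the gradient \<open>g\<close> with
  \<open>A\<inverse>DA\<inverse> g\<close>. The mass matrix \<open>A\<close> is symmetric, hence so is its inverse, and with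
  \<open>c = A\<inverse>g\<close> this number is \<open>c \<bullet> Dc\<close>. Since \<open>\<N>\<close> is linear, \<open>c \<bullet> Dc = \<langle>w, \<N> w\<rangle>\<close> for
  the trial function \<open>w = \<Sum>i. c\<^sub>i L\<^sub>i\<close> (\<open>quadratic_form_operator_matrix\<close>), and this is nonpositive
  because \<open>\<N>\<close> is negative semidefinite.

  The argument rests on \<open>A\<close> being invertible (\<open>invertible_mass_matrix\<close>), i.e. on the Lagrange
  functions being linearly independent in \<open>L\<^sup>2(S)\<close>, and not merely at the nodes. This is where the
  geometry enters. Every point of \<open>S\<close> has arbitrarily small neighbourhoods of positive and finite
  surface measure, because in a chart the density \<open>\<surd>det (D\<psi>\<^sup>T D\<psi>)\<close> is continuous and
  positive (\<open>surface_measure_small_neighbourhood\<close>). Finiteness and compactness make the surface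
  measure finite, so that continuous functions are square integrable; positivity implies
  that a continuous function with vanishing \<open>L\<^sup>2\<close> norm vanishes at every point of \<open>S\<close>. A
  combination of Lagrange functions whose norm is zero is therefore zero at the nodes, where its
  values are its coefficients.
\<close>

section \<open>The surface density in a chart\<close>

lemma invertible_iff_trivial_kernel:
  fixes A :: "real^'k^'k"
  shows "invertible A \<longleftrightarrow> (\<forall>v. A *v v = 0 \<longrightarrow> v = 0)"
  by (simp add: invertible_left_inverse matrix_left_invertible_ker)

text \<open>
  The segment from the identity to the Gram matrix \<open>J\<^sup>T J\<close> consists of positive definite, hence
  invertible, matrices. So the determinant cannot change its sign along it, and at the identity
  it is \<open>1\<close>.
\<close>

lemma det_gram_pos:
  fixes J :: "real^'m^'n"
  assumes "inj ((*v) J)"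
  shows "det (transpose J ** J) > 0"
proof (rule ccontr)
  assume neg: "\<not> ?thesis"
  define P where "P t = (\<chi> i j. (1 - t) * mat 1 $ i $ j + t * (transpose J ** J) $ i $ j)" for t :: real
  have P0: "P 0 = mat 1" and P1: "P 1 = transpose J ** J"
    by (simp_all add: P_def vec_eq_iff)
  have "continuous_on {0..1} (\<lambda>t. det (P t))"
    unfolding det_def P_def by (simp, intro continuous_intros)
  moreover have "det (P 1) \<le> 0" "0 \<le> det (P 0)"
    using neg P0 P1 by auto
  ultimately obtain t where t: "0 \<le> t" "t \<le> 1" "det (P t) = 0"
    using IVT2'[of "\<lambda>t. det (P t)" 1 0 0] by auto
  then obtain v where v: "v \<noteq> 0" "P t *v v = 0"
    using invertible_iff_trivial_kernel[of "P t"] invertible_det_nz[of "P t"] by auto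
  have "P t = (1 - t) *\<^sub>R mat 1 + t *\<^sub>R (transpose J ** J)"
    by (simp add: P_def vec_eq_iff)
  then have "P t *v v = (1 - t) *\<^sub>R v + t *\<^sub>R (transpose J *v (J *v v))"
    by (simp add: matrix_vector_mult_add_rdistrib scaleR_matrix_vector_assoc[symmetric]
        matrix_vector_mul_assoc)
  then have "v \<bullet> (P t *v v) = (1 - t) * (v \<bullet> v) + t * ((J *v v) \<bullet> (J *v v))"
    using dot_lmul_matrix[of "J *v v" J v] by (simp add: inner_add_right inner_commute)
  moreover have "J *v v \<noteq> 0"
    using assms v(1) by (metis injD matrix_vector_mult_0_right)
  then have "(1 - t) * (v \<bullet> v) + t * ((J *v v) \<bullet> (J *v v)) > 0"
    using t v(1) by (cases "t = 0") (auto intro: add_nonneg_pos)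
  ultimately show False
    using v(2) by simp
qed

text \<open>
  Smoothness only provides local representatives \<open>F\<close> of \<open>f\<close>; on an open set these have the same
  derivative as \<open>f\<close> near the point in question, so its regularity passes to the derivative of \<open>f\<close>.
\<close>

lemma smooth_on_open_derivative:
  fixes f :: "'a::euclidean_space \<Rightarrow> 'b::euclidean_space"
  assumes "open U" "smooth_on U f"
  shows "\<forall>x\<in>U. f differentiable (at x)"
    and "continuous_on U (\<lambda>x. frechet_derivative f (at x) v)"
proof -
  have *: "\<exists>V F. open V \<and> p \<in> V \<and> V \<subseteq> U \<and> continuous_on V (\<lambda>x. frechet_derivative F (at x) v) \<and>
             (\<forall>x\<in>V. (f has_derivative frechet_derivative F (at x)) (at x))" if "p \<in> U" for p
  proof -
    from assms(2)[unfolded smooth_on_def, rule_format, OF that]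
    obtain W F where W: "open W" "p \<in> W" "\<forall>k. Ck_on k W F" "\<forall>x\<in>U \<inter> W. F x = f x"
      by (elim exE conjE)
    from W(3) have "Ck_on (Suc 0) W F" by (rule spec)
    then have F: "\<forall>x\<in>W. F differentiable (at x)"
        "continuous_on W (\<lambda>x. frechet_derivative F (at x) v)"
      by simp_all
    have "(f has_derivative frechet_derivative F (at x)) (at x)" if "x \<in> U \<inter> W" for x
      using F(1) W that assms(1)
      by (intro has_derivative_transform_within_open[of F _ x UNIV "U \<inter> W" f])
         (auto simp: frechet_derivative_works[symmetric])
    then show ?thesis
      using W that assms(1) F(2)
      by (intro exI[of _ "U \<inter> W"] exI[of _ F]) (auto intro: continuous_on_subset)
  qed
  show "\<forall>x\<in>U. f differentiable (at x)"
    using * unfolding differentiable_def by blast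
  show "continuous_on U (\<lambda>x. frechet_derivative f (at x) v)"
  proof (rule continuous_at_imp_continuous_on, rule ballI)
    fix p assume "p \<in> U"
    from *[OF this] obtain V F where V: "open V" "p \<in> V" "V \<subseteq> U"
        "continuous_on V (\<lambda>x. frechet_derivative F (at x) v)"
        "\<forall>x\<in>V. (f has_derivative frechet_derivative F (at x)) (at x)"
      by blast
    have "continuous_on V (\<lambda>x. frechet_derivative f (at x) v)"
      using V(4)
    proof (rule continuous_on_eq)
      show "frechet_derivative F (at x) v = frechet_derivative f (at x) v" if "x \<in> V" for x
        using frechet_derivative_at[of f "frechet_derivative F (at x)" x] V(5) that by simp
    qed
    then show "isCont (\<lambda>x. frechet_derivative f (at x) v) p"
      using V continuous_on_eq_continuous_at by blast
  qed
qed

lemma gram_density_chart: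
  fixes \<psi> :: "real^'m \<Rightarrow> real^'n"
  assumes "local_parametrization S U \<psi>"
  shows "continuous_on U (gram_density \<psi>)"
    and "\<And>u. u \<in> U \<Longrightarrow> gram_density \<psi> u > 0"
proof -
  have U: "open U" "smooth_on U \<psi>" and inj: "\<forall>u\<in>U. inj (frechet_derivative \<psi> (at u))"
    using assms by (auto simp: local_parametrization_def)
  show "continuous_on U (gram_density \<psi>)"
    unfolding gram_density_def Let_def det_def matrix_def transpose_def matrix_matrix_mult_def
    by (simp, intro continuous_intros smooth_on_open_derivative(2)[OF U])
  show "gram_density \<psi> u > 0" if "u \<in> U" for u
  proof -
    have "linear (frechet_derivative \<psi> (at u))"
      using smooth_on_open_derivative(1)[OF U] that
      by (auto simp: frechet_derivative_works dest: has_derivative_linear)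
    then have "(*v) (matrix (frechet_derivative \<psi> (at u))) = frechet_derivative \<psi> (at u)"
      by (simp add: fun_eq_iff matrix_works)
    then show ?thesis
      using det_gram_pos[of "matrix (frechet_derivative \<psi> (at u))"] inj that
      by (auto simp: gram_density_def Let_def)
  qed
qed

section \<open>The surface measure\<close>

lemma space_surface_measure:
  assumes "surface_measure TYPE('m::finite) S \<sigma>"
  shows "space \<sigma> = S"
proof -
  have "sets \<sigma> = sets (restrict_space borel S)"
    using assms by (simp add: surface_measure_def)
  from sets_eq_imp_space_eq[OF this] show ?thesis
    by (simp add: space_restrict_space)
qed

text \<open>
  The neighbourhood is the chart image of a small ball, on which the continuous positive density
  lies between half of and twice its value at the centre.
\<close>

lemma surface_measure_small_neighbourhood:
  fixes S :: "(real^'n) set"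
  assumes S: "closed_smooth_surface TYPE('m::finite) S" and \<sigma>: "surface_measure TYPE('m) S \<sigma>"
    and V: "openin (top_of_set S) V" "p \<in> V"
  shows "\<exists>W. openin (top_of_set S) W \<and> p \<in> W \<and> W \<subseteq> V \<and> 0 < emeasure \<sigma> W \<and> emeasure \<sigma> W < \<infinity>"
proof -
  have "p \<in> S"
    using V openin_imp_subset by blast
  then obtain U and \<psi> :: "real^'m \<Rightarrow> real^'n" where \<psi>: "local_parametrization S U \<psi>" and "p \<in> \<psi> ` U"
    using S unfolding closed_smooth_surface_def by meson
  then obtain u where u: "u \<in> U" "p = \<psi> u" by blast
  from \<psi> obtain \<theta> where "open U" and im: "openin (top_of_set S) (\<psi> ` U)"
    and hom: "homeomorphism U (\<psi> ` U) \<psi> \<theta>"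
    by (auto simp: local_parametrization_def)
  note dens = gram_density_chart[OF \<psi>]
  define d where "d = gram_density \<psi> u"
  have d: "d > 0" using dens(2) u by (simp add: d_def)
  have "open (U \<inter> gram_density \<psi> -` {d/2<..<2*d})"
    using dens(1) \<open>open U\<close> by (intro continuous_open_preimage) auto
  moreover have "continuous_on U \<psi>"
    using hom by (simp add: homeomorphism_def)
  then have "open (U \<inter> \<psi> -` (\<psi> ` U \<inter> V))"
    using continuous_openin_preimage[of U \<psi> "\<psi> ` U" "\<psi> ` U \<inter> V"] \<open>open U\<close>
      openin_subset_trans[OF openin_Int[OF im V(1)] Int_lower1 openin_imp_subset[OF im]]
    by (simp add: openin_open_eq)
  ultimately have "open (U \<inter> gram_density \<psi> -` {d/2<..<2*d} \<inter> (U \<inter> \<psi> -` (\<psi> ` U \<inter> V)))"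
    by (rule open_Int)
  moreover have "u \<in> U \<inter> gram_density \<psi> -` {d/2<..<2*d} \<inter> (U \<inter> \<psi> -` (\<psi> ` U \<inter> V))"
    using u V d by (auto simp: d_def)
  ultimately obtain r where r: "r > 0"
    and ball: "ball u r \<subseteq> U \<inter> gram_density \<psi> -` {d/2<..<2*d} \<inter> (U \<inter> \<psi> -` (\<psi> ` U \<inter> V))"
    by (meson openE)
  define B where "B = ball u r"
  have B: "B \<subseteq> U" "B \<in> sets borel" and BV: "\<psi> ` B \<subseteq> V"
    and bnd: "\<And>w. w \<in> B \<Longrightarrow> d/2 \<le> gram_density \<psi> w \<and> gram_density \<psi> w \<le> 2*d"
    using ball unfolding B_def by (auto simp: less_imp_le subset_iff)
  have meas: "emeasure \<sigma> (\<psi> ` B) = (\<integral>\<^sup>+ w. ennreal (gram_density \<psi> w) * indicator B w \<partial>lborel)"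
    using \<sigma> \<psi> B by (auto simp: surface_measure_def)
  have "openin (top_of_set U) B"
    using B \<open>open U\<close> by (simp add: B_def openin_open_eq)
  then have "openin (top_of_set S) (\<psi> ` B)"
    using homeomorphism_imp_open_map[OF hom] im openin_trans by blast
  moreover have "p \<in> \<psi> ` B"
    using u r by (simp add: B_def)
  moreover have "0 < emeasure \<sigma> (\<psi> ` B)"
  proof -
    have "0 < ennreal (d/2) * emeasure lborel B"
      using d r by (simp add: B_def emeasure_ball ennreal_zero_less_mult_iff)
    also have "\<dots> = (\<integral>\<^sup>+ w. ennreal (d/2) * indicator B w \<partial>lborel)"
      using B by (simp add: nn_integral_cmult_indicator)
    also have "\<dots> \<le> emeasure \<sigma> (\<psi> ` B)"
      unfolding meas using bnd by (intro nn_integral_mono) (auto simp: indicator_def ennreal_leI)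
    finally show ?thesis .
  qed
  moreover have "emeasure \<sigma> (\<psi> ` B) < \<infinity>"
  proof -
    have "emeasure \<sigma> (\<psi> ` B) \<le> (\<integral>\<^sup>+ w. ennreal (2*d) * indicator B w \<partial>lborel)"
      unfolding meas using bnd by (intro nn_integral_mono) (auto simp: indicator_def ennreal_leI)
    also have "\<dots> = ennreal (2*d) * emeasure lborel B"
      using B by (simp add: nn_integral_cmult_indicator)
    also have "\<dots> < \<infinity>"
      using emeasure_lborel_ball_finite[of u r] by (simp add: B_def ennreal_mult_less_top)
    finally show ?thesis .
  qed
  ultimately show ?thesis
    using BV by blast
qed

text \<open>Compactness: finitely many of the neighbourhoods of finite measure cover \<open>S\<close>.\<close>

lemma finite_measure_surface:
  fixes S :: "(real^'n) set"
  assumes S: "closed_smooth_surface TYPE('m::finite) S" and \<sigma>: "surface_measure TYPE('m) S \<sigma>"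
  shows "finite_measure \<sigma>"
proof
  have sets: "sets \<sigma> = sets (restrict_space borel S)"
    using \<sigma> by (simp add: surface_measure_def)
  have "\<exists>W. openin (top_of_set S) W \<and> p \<in> W \<and> emeasure \<sigma> W < \<infinity>" if "p \<in> S" for p
    using surface_measure_small_neighbourhood[OF S \<sigma>, of S p] that by auto
  then obtain W where W: "\<And>p. p \<in> S \<Longrightarrow> openin (top_of_set S) (W p) \<and> p \<in> W p \<and> emeasure \<sigma> (W p) < \<infinity>"
    by metis
  then have "\<exists>G. open G \<and> W p = S \<inter> G" if "p \<in> S" for p
    using that openin_open by blast
  then obtain G where G: "\<And>p. p \<in> S \<Longrightarrow> open (G p) \<and> W p = S \<inter> G p"
    by metis
  have "compact S"
    using S by (simp add: closed_smooth_surface_def)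
  moreover have "p \<in> G p" if "p \<in> S" for p
    using W[OF that] G[OF that] by simp
  then have "S \<subseteq> (\<Union>p\<in>S. G p)" by blast
  ultimately obtain C where C: "C \<subseteq> S" "finite C" "S \<subseteq> (\<Union>p\<in>C. G p)"
    using compactE_image[of S S G] G by metis
  have "W p \<in> sets \<sigma>" if "p \<in> C" for p
    using G[of p] C that by (auto simp: sets sets_restrict_space)
  then have "emeasure \<sigma> (\<Union>p\<in>C. W p) \<le> (\<Sum>p\<in>C. emeasure \<sigma> (W p))"
    using C by (intro emeasure_subadditive_finite) auto
  also have "\<dots> < \<infinity>"
    using C W by (auto simp: less_top[symmetric])
  also have "(\<Union>p\<in>C. W p) = space \<sigma>"
    using C G by (auto simp: space_surface_measure[OF \<sigma>] subset_iff)
  finally show "emeasure \<sigma> (space \<sigma>) \<noteq> \<infinity>" by simp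
qed

lemma continuous_on_surface_in_l2_space:
  fixes S :: "(real^'n) set"
  assumes S: "closed_smooth_surface TYPE('m::finite) S" and \<sigma>: "surface_measure TYPE('m) S \<sigma>"
    and f: "continuous_on S f"
  shows "f \<in> l2_space \<sigma>"
proof -
  interpret finite_measure \<sigma> by (rule finite_measure_surface[OF S \<sigma>])
  have sets: "sets \<sigma> = sets (restrict_space borel S)"
    using \<sigma> by (simp add: surface_measure_def)
  have meas [measurable]: "f \<in> borel_measurable \<sigma>"
    using borel_measurable_continuous_on_restrict[OF f]
    by (simp add: measurable_cong_sets[OF sets refl])
  have "compact (f ` S)"
    using S f by (simp add: closed_smooth_surface_def compact_continuous_image)
  then have "bounded (f ` S)"
    by (rule compact_imp_bounded)
  then obtain B where B: "\<And>x. x \<in> S \<Longrightarrow> \<bar>f x\<bar> \<le> B"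
    by (auto simp: bounded_iff)
  have "(f x)\<^sup>2 \<le> B\<^sup>2" if "x \<in> S" for x
    using power_mono[OF B[OF that], of 2] by simp
  then have "integrable \<sigma> (\<lambda>x. (f x)\<^sup>2)"
    by (intro integrable_const_bound[of _ "B\<^sup>2"] AE_I2) (auto simp: space_surface_measure[OF \<sigma>])
  then show ?thesis
    using meas by (simp add: l2_space_def)
qed

text \<open>
  If \<open>f\<close> were nonzero at a point, then a neighbourhood of that point with positive measure
  would lie in the null set where \<open>f\<close> does not vanish.
\<close>

lemma continuous_on_surface_l2_norm_zero:
  fixes S :: "(real^'n) set"
  assumes S: "closed_smooth_surface TYPE('m::finite) S" and \<sigma>: "surface_measure TYPE('m) S \<sigma>"
    and f: "continuous_on S f" and zero: "l2_inner \<sigma> f f = 0" and "p \<in> S"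
  shows "f p = 0"
proof (rule ccontr)
  assume "f p \<noteq> 0"
  have [measurable]: "f \<in> borel_measurable \<sigma>" and "integrable \<sigma> (\<lambda>x. (f x)\<^sup>2)"
    using continuous_on_surface_in_l2_space[OF S \<sigma> f] by (auto simp: l2_space_def)
  then have "AE x in \<sigma>. (f x)\<^sup>2 = 0"
    using zero by (subst integral_nonneg_eq_0_iff_AE[symmetric]) (auto simp: l2_inner_def power2_eq_square)
  then have null: "emeasure \<sigma> {x\<in>space \<sigma>. f x \<noteq> 0} = 0"
    by (subst AE_iff_measurable[symmetric, where P = "\<lambda>x. f x = 0"]) auto
  have "openin (top_of_set S) (S \<inter> f -` (- {0}))"
    using f by (intro continuous_openin_preimage_gen) auto
  then obtain W where "W \<subseteq> S \<inter> f -` (- {0})" "0 < emeasure \<sigma> W"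
    using surface_measure_small_neighbourhood[OF S \<sigma>, of "S \<inter> f -` (- {0})" p]
      \<open>p \<in> S\<close> \<open>f p \<noteq> 0\<close> by auto
  moreover from this have "W \<subseteq> {x\<in>space \<sigma>. f x \<noteq> 0}"
    by (auto simp: space_surface_measure[OF \<sigma>])
  then have "emeasure \<sigma> W \<le> emeasure \<sigma> {x\<in>space \<sigma>. f x \<noteq> 0}"
    by (rule emeasure_mono) measurable
  ultimately show False
    using null by simp
qed

section \<open>Galerkin matrices as quadratic forms\<close>

lemma l2_space_mult_integrable:
  assumes "f \<in> l2_space M" "g \<in> l2_space M"
  shows "integrable M (\<lambda>x. f x * g x)"
proof (rule Bochner_Integration.integrable_bound)
  show "integrable M (\<lambda>x. (f x)\<^sup>2 + (g x)\<^sup>2)"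
    using assms by (simp add: l2_space_def)
  show "(\<lambda>x. f x * g x) \<in> borel_measurable M"
    using assms by (auto simp: l2_space_def)
  have "\<bar>a * b\<bar> \<le> \<bar>a\<^sup>2 + b\<^sup>2\<bar>" for a b :: real
    using sum_squares_bound[of a b] sum_squares_bound[of a "- b"]
      zero_le_power2[of a] zero_le_power2[of b] by (simp add: abs_le_iff)
  then show "AE x in M. norm (f x * g x) \<le> norm ((f x)\<^sup>2 + (g x)\<^sup>2)"
    by simp
qed

lemma quadratic_form_l2_inner:
  fixes f g :: "'k::finite \<Rightarrow> 'a \<Rightarrow> real"
  assumes "\<And>i. f i \<in> l2_space M" "\<And>i. g i \<in> l2_space M"
  shows "c \<bullet> ((\<chi> i j. l2_inner M (f i) (g j)) *v c) = l2_inner M (lin_comb f c) (lin_comb g c)"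
proof -
  note int = l2_space_mult_integrable[OF assms]
  have "l2_inner M (lin_comb f c) (lin_comb g c)
      = (\<integral>x. (\<Sum>i\<in>UNIV. \<Sum>j\<in>UNIV. (c $ i * c $ j) * (f i x * g j x)) \<partial>M)"
    by (simp add: l2_inner_def lin_comb_def sum_product mult_ac)
  also have "\<dots> = (\<Sum>i\<in>UNIV. \<Sum>j\<in>UNIV. (c $ i * c $ j) * l2_inner M (f i) (g j))"
    using int by (simp add: l2_inner_def)
  also have "\<dots> = c \<bullet> ((\<chi> i j. l2_inner M (f i) (g j)) *v c)"
    by (simp add: inner_vec_def matrix_vector_mult_def sum_distrib_left mult_ac)
  finally show ?thesis ..
qed

lemma function_space_combination:
  assumes "function_space S \<U>" "u \<in> \<U>" "v \<in> \<U>"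
  shows "(\<lambda>x. a * u x + b * v x) \<in> \<U>"
proof -
  have "\<forall>u\<in>\<U>. \<forall>v\<in>\<U>. \<forall>a b. (\<lambda>x. a * u x + b * v x) \<in> \<U>"
    using assms(1) by (simp add: function_space_def)
  from this[rule_format, OF assms(2,3)] show ?thesis .
qed

lemma function_space_sum:
  assumes space: "function_space S \<U>" and L: "\<And>i. i \<in> I \<Longrightarrow> L i \<in> \<U>" and "finite I"
  shows "(\<lambda>y. \<Sum>i\<in>I. c i * L i y) \<in> \<U>"
  using \<open>finite I\<close> L
proof (induction I rule: finite_induct)
  case empty
  then show ?case using space by (simp add: function_space_def)
next
  case (insert k I)
  then show ?case
    using function_space_combination[OF space, of "L k" "\<lambda>y. \<Sum>i\<in>I. c i * L i y" "c k" 1] by simp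
qed

lemma lin_comb_in_function_space:
  assumes "function_space S \<U>" "\<And>i. L i \<in> \<U>"
  shows "lin_comb L c \<in> \<U>"
  unfolding lin_comb_def using assms by (intro function_space_sum) auto

lemma linear_l2_operator_lin_comb:
  assumes space: "function_space S \<U>" and N: "linear_l2_operator \<sigma> \<U> N" and L: "\<And>i. L i \<in> \<U>"
  shows "AE y in \<sigma>. N (lin_comb L c) y = lin_comb (\<lambda>i. N (L i)) c y"
proof -
  have lin: "AE y in \<sigma>. N (\<lambda>y. a * u y + b * v y) y = a * N u y + b * N v y"
    if "u \<in> \<U>" "v \<in> \<U>" for u v a b
    using N that unfolding linear_l2_operator_def by blast
  have "AE y in \<sigma>. N (\<lambda>y. \<Sum>i\<in>I. c $ i * L i y) y = (\<Sum>i\<in>I. c $ i * N (L i) y)" if "finite I" for I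
    using that
  proof (induction I rule: finite_induct)
    case empty
    have "(\<lambda>x. 0) \<in> \<U>" using space by (simp add: function_space_def)
    \<comment> \<open>the combination with coefficients \<open>0\<close> shows that \<open>N\<close> maps the zero function to zero
      almost everywhere\<close>
    then show ?case using lin[of "\<lambda>x. 0" "\<lambda>x. 0" 0 0] by simp
  next
    case (insert k I)
    let ?s = "\<lambda>y. \<Sum>i\<in>I. c $ i * L i y"
    have "?s \<in> \<U>"
      using function_space_sum[OF space L insert.hyps(1)] .
    then have "AE y in \<sigma>. N (\<lambda>y. c $ k * L k y + 1 * ?s y) y = c $ k * N (L k) y + 1 * N ?s y"
      by (rule lin[OF L])
    with insert.IH have "AE y in \<sigma>. N (\<lambda>y. c $ k * L k y + 1 * ?s y) y
        = c $ k * N (L k) y + (\<Sum>i\<in>I. c $ i * N (L i) y)"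
      by eventually_elim simp
    then show ?case using insert.hyps by simp
  qed
  then show ?thesis by (simp add: lin_comb_def)
qed

text \<open>
  Linearity of \<open>N\<close> holds only almost everywhere, which is enough under the integral.
\<close>

lemma quadratic_form_operator_matrix:
  fixes L :: "'k::finite \<Rightarrow> real^'n \<Rightarrow> real"
  assumes space: "function_space S \<U>" and N: "linear_l2_operator \<sigma> \<U> N"
    and L: "\<And>i. L i \<in> \<U>" and l2: "\<And>u. u \<in> \<U> \<Longrightarrow> u \<in> l2_space \<sigma>"
  shows "c \<bullet> (operator_matrix \<sigma> N L *v c) = l2_inner \<sigma> (lin_comb L c) (N (lin_comb L c))"
proof -
  have NL: "N u \<in> l2_space \<sigma>" if "u \<in> \<U>" for u
    using N that by (simp add: linear_l2_operator_def)
  have w: "lin_comb L c \<in> \<U>"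
    using lin_comb_in_function_space[OF space L] .
  have "c \<bullet> (operator_matrix \<sigma> N L *v c) = l2_inner \<sigma> (lin_comb L c) (lin_comb (\<lambda>i. N (L i)) c)"
    unfolding operator_matrix_def using L NL l2 by (intro quadratic_form_l2_inner) auto
  also have "\<dots> = l2_inner \<sigma> (lin_comb L c) (N (lin_comb L c))"
    unfolding l2_inner_def
  proof (rule integral_cong_AE)
    have meas: "f \<in> borel_measurable \<sigma>" if "f \<in> l2_space \<sigma>" for f
      using that by (simp add: l2_space_def)
    have [measurable]: "\<And>i. L i \<in> borel_measurable \<sigma>" "\<And>i. N (L i) \<in> borel_measurable \<sigma>"
        "N (lin_comb L c) \<in> borel_measurable \<sigma>"
      by (intro meas l2 NL L w)+
    have [measurable]: "lin_comb L c \<in> borel_measurable \<sigma>"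
        "lin_comb (\<lambda>i. N (L i)) c \<in> borel_measurable \<sigma>"
      unfolding lin_comb_def by measurable
    show "(\<lambda>y. lin_comb L c y * lin_comb (\<lambda>i. N (L i)) c y) \<in> borel_measurable \<sigma>"
        "(\<lambda>y. lin_comb L c y * N (lin_comb L c) y) \<in> borel_measurable \<sigma>"
      by measurable
    show "AE y in \<sigma>. lin_comb L c y * lin_comb (\<lambda>i. N (L i)) c y = lin_comb L c y * N (lin_comb L c) y"
      using linear_l2_operator_lin_comb[where L = L and c = c, OF space N L] by eventually_elim simp
  qed
  finally show ?thesis .
qed

text \<open>
  For singular matrices \<open>matrix_inv\<close> is an arbitrary matrix, so the semi-discrete system has its
  meaning only through this lemma. A vector \<open>c\<close> in the kernel of the mass matrix gives a trial function of \<open>L\<^sup>2\<close> norm zero, which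
  then vanishes at the nodes; its value at the node \<open>x j\<close> is \<open>c $ j\<close>.
\<close>

lemma invertible_mass_matrix:
  fixes S :: "(real^'n) set" and L :: "'k::finite \<Rightarrow> real^'n \<Rightarrow> real"
  assumes S: "closed_smooth_surface TYPE('m::finite) S" and \<sigma>: "surface_measure TYPE('m) S \<sigma>"
    and cont: "\<And>i. continuous_on S (L i)" and x: "range x \<subseteq> S"
    and nodal: "\<And>i j. L i (x j) = (if i = j then 1 else 0)"
  shows "invertible (mass_matrix \<sigma> L)"
proof -
  have "c = 0" if c: "mass_matrix \<sigma> L *v c = 0" for c
  proof -
    have "l2_inner \<sigma> (lin_comb L c) (lin_comb L c) = c \<bullet> (mass_matrix \<sigma> L *v c)"
      unfolding mass_matrix_def
      by (intro quadratic_form_l2_inner[symmetric] continuous_on_surface_in_l2_space[OF S \<sigma>] cont)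
    then have norm: "l2_inner \<sigma> (lin_comb L c) (lin_comb L c) = 0"
      using c by simp
    have "continuous_on S (lin_comb L c)"
      unfolding lin_comb_def by (intro continuous_intros cont)
    then have "lin_comb L c (x j) = 0" for j
      using continuous_on_surface_l2_norm_zero[OF S \<sigma> _ norm] x by blast
    moreover have "lin_comb L c (x j) = c $ j" for j
      by (simp add: lin_comb_def nodal if_distrib cong: if_cong)
    ultimately show "c = 0" by (simp add: vec_eq_iff)
  qed
  then show ?thesis
    by (simp add: invertible_iff_trivial_kernel)
qed

lemma transpose_matrix_inv_symmetric:
  fixes A :: "real^'k^'k"
  assumes "invertible A" "transpose A = A"
  shows "transpose (matrix_inv A) = matrix_inv A"
proof -
  have inv: "A ** matrix_inv A = mat 1" "matrix_inv A ** A = mat 1"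
    using someI_ex[OF assms(1)[unfolded invertible_def]] by (auto simp: matrix_inv_def)
  have "transpose (matrix_inv A) ** A = mat 1"
    using arg_cong[OF inv(1), of transpose] assms(2) by (simp add: matrix_transpose_mul)
  then have "transpose (matrix_inv A) ** A ** matrix_inv A = matrix_inv A"
    by simp
  then show ?thesis
    using inv(1) by (simp add: matrix_mul_assoc[symmetric])
qed

section \<open>Dissipation of energy\<close>

lemma gderiv_chain_within:
  fixes f :: "'a::real_inner \<Rightarrow> real"
  assumes "GDERIV f (\<alpha> t) :> g" "(\<alpha> has_vector_derivative v) (at t within I)"
  shows "((\<lambda>s. f (\<alpha> s)) has_real_derivative g \<bullet> v) (at t within I)"
proof -
  have "((\<lambda>s. f (\<alpha> s)) has_derivative (\<lambda>h. (h *\<^sub>R v) \<bullet> g)) (at t within I)"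
    using assms has_derivative_compose unfolding gderiv_def has_vector_derivative_def by blast
  then show ?thesis
    by (simp add: has_field_derivative_def inner_commute mult_commute_abs)
qed

theorem theorem3p1:
  fixes S :: "(real^'n) set"
    and \<sigma> :: "(real^'n) measure"
    and \<U> :: "(real^'n \<Rightarrow> real) set"
    and N :: "(real^'n \<Rightarrow> real) \<Rightarrow> real^'n \<Rightarrow> real"
    and E :: "(real^'n \<Rightarrow> real) \<Rightarrow> real"
    and \<delta>E :: "(real^'n \<Rightarrow> real) \<Rightarrow> real^'n \<Rightarrow> real"
    and m :: nat
    and \<phi> :: "real^'n \<Rightarrow> real^'n \<Rightarrow> real"
    and x :: "'k::finite \<Rightarrow> real^'n"
    and L :: "'k \<Rightarrow> real^'n \<Rightarrow> real"
    and T :: real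
    and \<alpha> :: "real \<Rightarrow> real^'k"
  assumes dim: "CARD('n) = CARD('m::finite) + 1"
    and surface: "closed_smooth_surface TYPE('m) S"
    and measure: "surface_measure TYPE('m) S \<sigma>"
    and space: "function_space S \<U>"
    and N_linear: "linear_l2_operator \<sigma> \<U> N"
    and N_self_adjoint: "self_adjoint_on \<sigma> \<U> N"
    and N_negative: "negative_semidefinite_on \<sigma> \<U> N"
    and energy: "has_functional_derivative \<sigma> \<U> E \<delta>E"
    and kernel: "matern_kernel S \<sigma> m \<phi>"
    and points: "inj x" "range x \<subseteq> S"
    and trial_space: "kernel_span (range x) \<phi> \<subseteq> \<U>"
    and lagrange: "lagrange_functions \<phi> x L"
    and T: "T > 0"
    and solution: "semidiscrete_solution \<sigma> N E L T \<alpha>"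
  shows "\<forall>t\<in>{0<..T}. \<exists>D\<le>0.
    ((\<lambda>s. E (lin_comb L (\<alpha> s))) has_real_derivative D) (at t within {0<..T})"
proof
  fix t assume t: "t \<in> {0<..T}"
  let ?A = "mass_matrix \<sigma> L" and ?D = "operator_matrix \<sigma> N L"
  from solution[unfolded semidiscrete_solution_def, rule_format, OF t]
  obtain g where g: "GDERIV (\<lambda>a. E (lin_comb L a)) (\<alpha> t) :> g"
    and \<alpha>: "(\<alpha> has_vector_derivative (matrix_inv ?A ** ?D ** matrix_inv ?A) *v g) (at t within {0<..T})"
    by (elim exE conjE)
  have L: "L i \<in> \<U>" for i
    using lagrange trial_space by (auto simp: lagrange_functions_def)
  have cont: "continuous_on S u" if "u \<in> \<U>" for u
    using space that by (auto simp: function_space_def intro: differentiable_imp_continuous_on)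
  have inv: "invertible ?A"
    using invertible_mass_matrix[where L = L, OF surface measure cont[OF L] points(2)] lagrange
    by (simp add: lagrange_functions_def)
  have "transpose ?A = ?A"
    by (simp add: mass_matrix_def transpose_def l2_inner_def mult.commute)
  then have sym: "transpose (matrix_inv ?A) = matrix_inv ?A"
    using inv transpose_matrix_inv_symmetric by blast
  \<comment> \<open>\<open>c\<close> holds the coefficients of the \<open>L\<^sup>2\<close> projection of the functional derivative onto the
    trial space\<close>
  define c where "c = matrix_inv ?A *v g"
  have "g \<bullet> ((matrix_inv ?A ** ?D ** matrix_inv ?A) *v g) = g \<bullet> (matrix_inv ?A *v (?D *v c))"
    by (simp add: c_def matrix_vector_mul_assoc matrix_mul_assoc)
  also have "\<dots> = c \<bullet> (?D *v c)"
    using sym by (metis c_def dot_lmul_matrix vector_transpose_matrix)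
  also have "\<dots> = l2_inner \<sigma> (lin_comb L c) (N (lin_comb L c))"
    using quadratic_form_operator_matrix[where L = L and c = c, OF space N_linear L] cont
      continuous_on_surface_in_l2_space[OF surface measure] by blast
  also have "\<dots> \<le> 0"
    using N_negative lin_comb_in_function_space[where L = L and c = c, OF space L]
    by (simp add: negative_semidefinite_on_def)
  finally show "\<exists>D\<le>0. ((\<lambda>s. E (lin_comb L (\<alpha> s))) has_real_derivative D) (at t within {0<..T})"
    using gderiv_chain_within[OF g \<alpha>] by blast
qed

end
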